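(* Let $q$ be a prime power and $n$ an odd positive integer, and let $\tau(n)$ be the number of positive divisors of $n$. (1) If $q\equiv 3\pmod 4$, the elliptic curve $y^2=x^3-(t^{q^n+1}+1)x$ over $\mathbb{F}_q(t)$ has at least $\tau(n)$ $\infty$-integral points. (2) If $q\equiv 2\pmod 3$, the elliptic curve $y^2=x^3+t^{q^n+1}+1$ over $\mathbb{F}_q(t)$ has at least $\tau(n)$ $\infty$-integral points.
   Context: A point $(F(t),G(t))$ on such a curve is $\infty$-integral if $F,G\in\mathbb{F}_q[t]$.
   Formalization: In (2) it is assumed that the curve is elliptic (nonzero discriminant), i.e. that q is odd; for even q the equation is not an elliptic curve and the count fails, e.g. q=2, n=3 has the single ∞-integral point (t^3,1) while τ(3)=2. *)

theory Defs
  imports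
    "HOL-Computational_Algebra.Computational_Algebra"
    "HOL-Library.Cardinality"
    "HOL-Number_Theory.Prime_Powers"
begin

text \<open>
  The curves are short Weierstrass cubics \<open>y^2 = x^3 + A x + B\<close>, given by the pair \<open>A\<close>, \<open>B\<close>.
  The polynomial \<open>-16 (4 A^3 + 27 B^2)\<close> is the discriminant of this equation in every
  characteristic; in particular it vanishes identically in characteristic 2, where such a cubic
  is never smooth over the algebraic closure.
\<close>

definition elliptic_curve :: "'k::field \<Rightarrow> 'k \<Rightarrow> bool" where
  "elliptic_curve A B \<longleftrightarrow> - 16 * (4 * A ^ 3 + 27 * B ^ 2) \<noteq> 0"

definition affine_points :: "'k::field \<Rightarrow> 'k \<Rightarrow> ('k \<times> 'k) set" where
  "affine_points A B = {(x, y). y ^ 2 = x ^ 3 + A * x + B}"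

text \<open>
  For a field \<open>'a\<close>, the rational function field \<open>'a(t)\<close> is \<open>'a poly fract\<close>, and \<open>'a[t]\<close> is the
  range of \<open>to_fract\<close> in it. The point at infinity is not of the form \<open>(F(t), G(t))\<close>, so it does
  not count as an integral point.
\<close>

definition ratfun_t :: "'a::field poly fract" where
  "ratfun_t = to_fract [:0, 1:]"

definition infty_integral_points ::
    "'a::field poly fract \<Rightarrow> 'a poly fract \<Rightarrow> ('a poly fract \<times> 'a poly fract) set" where
  "infty_integral_points A B = {(F, G) \<in> affine_points A B. F \<in> range to_fract \<and> G \<in> range to_fract}"

definition num_divisors :: "nat \<Rightarrow> nat" where
  "num_divisors n = card {d. d dvd n}"

text \<open>Stated through a finite subset, because \<open>card\<close> of an infinite set is 0.\<close>

definition has_at_least :: "'b set \<Rightarrow> nat \<Rightarrow> bool" where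
  "has_at_least X k \<longleftrightarrow> (\<exists>S. S \<subseteq> X \<and> finite S \<and> card S = k)"

end

theory Submission
  imports Defs
begin

text \<open>
  Both parts come from writing \<open>h = t^(q^n+1) + 1\<close> as \<open>U^(q+1) + V^(q+1)\<close> with \<open>U\<close>, \<open>V\<close> polynomials:
  such a decomposition gives the point \<open>(-U^((q+1)/2), U^((q+1)/4) V^((q+1)/2))\<close> on \<open>y^2 = x^3 - h x\<close>
  and the point \<open>(-U^((q+1)/3), V^((q+1)/2))\<close> on \<open>y^2 = x^3 + h\<close>. For \<open>d\<close> dividing \<open>n\<close> put
  \<open>T = t^((q^n+1)/(q^d+1))\<close> and \<open>e = (q^d+1)/(q+1)\<close>. The rotation \<open>(A, B) \<mapsto> ((A+B)/2, (A-B)/2)\<close>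
  halves the form \<open>A^(q+1) + B^(q+1)\<close>, and \<open>(T+1)^(q^d+1) + (T-1)^(q^d+1) = 2 (T^(q^d+1) + 1)\<close>, so
  \<open>A = (T+1)^e\<close>, \<open>B = (T-1)^e\<close> yield a decomposition. As \<open>e\<close> is odd and \<open>e = 1\<close> in the field, \<open>U\<close>
  starts with the term \<open>T\<close>, hence its order at \<open>t = 0\<close> determines \<open>d\<close>.
\<close>

section \<open>Odd cofactors and the identity for sums of \<open>(q + 1)\<close>-th powers\<close>

lemma odd_power_Suc_factor:
  fixes q d :: nat
  assumes "odd q" "odd d"
  shows "\<exists>e. odd e \<and> q ^ d + 1 = e * (q + 1)"
proof -
  obtain m where d: "d = 2 * m + 1" using \<open>odd d\<close> by (rule oddE)
  obtain a where q: "q = 2 * a + 1" using \<open>odd q\<close> by (rule oddE)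
  have "\<exists>k. q ^ (2 * m + 1) + 1 = (2 * k + 1) * (q + 1)"
  proof (induction m)
    case 0
    show ?case by (rule exI[of _ 0]) simp
  next
    case (Suc m)
    then obtain k where k: "q ^ (2 * m + 1) + 1 = (2 * k + 1) * (q + 1)" by blast
    \<comment> \<open>Raising the exponent by 2 turns the cofactor \<open>2 * k + 1\<close> into
      \<open>(2 * k + 1) * q\<^sup>2 - (q - 1)\<close>, which is odd because \<open>q\<close> is.
      Adding \<open>q\<^sup>2\<close> to both sides avoids subtraction on naturals.\<close>
    have "q ^ (2 * Suc m + 1) + 1 + q\<^sup>2 = q\<^sup>2 * (q ^ (2 * m + 1) + 1) + 1"
      by (simp add: algebra_simps power2_eq_square)
    also have "\<dots> = q\<^sup>2 * ((2 * k + 1) * (q + 1)) + 1"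
      by (simp only: k)
    also have "\<dots> = (2 * (k * q\<^sup>2 + 2 * a\<^sup>2 + a) + 1) * (q + 1) + q\<^sup>2"
      unfolding q by (simp add: algebra_simps power2_eq_square)
    finally show ?case by (metis add_right_cancel)
  qed
  then show ?thesis unfolding d by (metis even_plus_one_iff dvd_triv_left)
qed

text \<open>The maps \<open>x ^ q\<close> and \<open>x ^ r\<close> are additive, being powers of
  Frobenius, so \<open>x ^ (q + 1) = x ^ q * x\<close> expands like a quadratic form: the cross
  terms of the two rotated coordinates cancel.\<close>

lemma frobenius_norm_identity:
  fixes T c :: "'b::comm_ring_1"
  assumes p: "prime CHAR('b)" and q: "q = CHAR('b) ^ i" and r: "r = CHAR('b) ^ j"
    and c: "2 * c = 1" and e: "e * (q + 1) = r + 1"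
  shows "(c * ((T + 1) ^ e + (T - 1) ^ e)) ^ (q + 1)
       + (c * ((T + 1) ^ e - (T - 1) ^ e)) ^ (q + 1) = T ^ (r + 1) + 1"
proof -
  have add: "(x + y) ^ CHAR('b) ^ l = x ^ CHAR('b) ^ l + y ^ CHAR('b) ^ l" for x y :: 'b and l
    using freshmans_dream'[of "CHAR('b) ^ l" l x y] p by simp
  have diff: "(x - y) ^ CHAR('b) ^ l = x ^ CHAR('b) ^ l - y ^ CHAR('b) ^ l" for x y :: 'b and l
    using add[of "x - y" y l] by (simp add: algebra_simps)
  \<comment> \<open>Frobenius fixes 2 = 1 + 1, hence also its inverse \<open>c\<close>.\<close>
  have "(2::'b) ^ q = 2"
    using add[of 1 1 i] unfolding q by simp
  then have "2 * c ^ q = 1"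
    using c by (metis power_mult_distrib power_one)
  then have cq: "c ^ q = c"
    using c by (metis mult.assoc mult.commute mult.right_neutral)
  define A B where "A = (T + 1) ^ e" and "B = (T - 1) ^ e"
  have pow: "(x ^ e) ^ q * x ^ e = x ^ r * x" for x :: 'b
  proof -
    have "(x ^ e) ^ q * x ^ e = x ^ (e * (q + 1))" by (simp add: power_add power_mult)
    then show ?thesis unfolding e by simp
  qed
  have A: "A ^ q * A = (T ^ r + 1) * (T + 1)"
    unfolding A_def pow using add[of T 1 j] r by simp
  have B: "B ^ q * B = (T ^ r - 1) * (T - 1)"
    unfolding B_def pow using diff[of T 1 j] r by simp
  have "(c * (A + B)) ^ (q + 1) + (c * (A - B)) ^ (q + 1)
      = c * ((A ^ q + B ^ q) * (c * (A + B))) + c * ((A ^ q - B ^ q) * (c * (A - B)))"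
    using add[of A B i] diff[of A B i] cq unfolding q by (simp add: power_mult_distrib ac_simps)
  also have "\<dots> = (2 * c) * (c * (A ^ q * A + B ^ q * B))"
    by (simp add: algebra_simps)
  also have "\<dots> = (2 * c) * ((2 * c) * (T ^ r * T + 1))"
    unfolding A B by (simp add: algebra_simps)
  finally show ?thesis unfolding A_def B_def c by simp
qed

section \<open>Expansions and orders at zero\<close>

lemma one_plus_power_expansion:
  fixes x :: "'b::comm_ring_1"
  shows "\<exists>s. (1 + x) ^ e = 1 + of_nat e * x + x\<^sup>2 * s"
proof (induction e)
  case 0
  show ?case by (rule exI[of _ 0]) simp
next
  case (Suc e)
  then obtain s where s: "(1 + x) ^ e = 1 + of_nat e * x + x\<^sup>2 * s" by blast
  have "(1 + x) ^ Suc e = 1 + of_nat (Suc e) * x + x\<^sup>2 * (of_nat e + s + x * s)"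
    unfolding power_Suc s by (simp add: algebra_simps power2_eq_square)
  then show ?case by blast
qed

text \<open>For odd \<open>e\<close> the sum is an odd function of \<open>x\<close>, so its constant
  term cancels and the linear coefficient doubles. The factored form shows the order at zero once
  \<open>e\<close> is nonzero in the ring.\<close>

lemma odd_power_half_sum_expansion:
  fixes x c :: "'b::comm_ring_1"
  assumes "odd e" and c: "2 * c = 1"
  shows "\<exists>s. c * ((x + 1) ^ e + (x - 1) ^ e) = x * (of_nat e + x * s)"
proof -
  obtain s where s: "(1 + x) ^ e = 1 + of_nat e * x + x\<^sup>2 * s"
    using one_plus_power_expansion by blast
  obtain s' where s': "(1 + - x) ^ e = 1 + of_nat e * - x + (- x)\<^sup>2 * s'"
    using one_plus_power_expansion by blast
  have plus: "(x + 1) ^ e = 1 + of_nat e * x + x\<^sup>2 * s"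
    using s by (simp add: add.commute)
  have "(x - 1) ^ e = (- (1 + - x)) ^ e" by simp
  also have "\<dots> = - ((1 + - x) ^ e)" using \<open>odd e\<close> by (rule power_minus_odd)
  finally have minus: "(x - 1) ^ e = - (1 + of_nat e * - x + (- x)\<^sup>2 * s')"
    unfolding s' .
  have "c * ((x + 1) ^ e + (x - 1) ^ e) = (2 * c) * (of_nat e * x) + x * (x * (c * (s - s')))"
    unfolding plus minus by (simp add: algebra_simps power2_eq_square)
  then have "c * ((x + 1) ^ e + (x - 1) ^ e) = x * (of_nat e + x * (c * (s - s')))"
    unfolding c by (simp add: algebra_simps)
  then show ?thesis by blast
qed

lemma order_power_eq:
  fixes p :: "'a::idom poly"
  assumes "p \<noteq> 0"
  shows "order a (p ^ j) = j * order a p"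
  using assms by (induction j) (auto simp: order_mult)

section \<open>Characteristic and parity of a finite field\<close>

lemma CHAR_dvd_card:
  assumes "finite (UNIV :: 'a::ring_1 set)"
  shows "CHAR('a) dvd CARD('a)"
proof -
  \<comment> \<open>Translation by 1 permutes the ring; comparing the two sums leaves
    \<open>CARD('a)\<close> copies of 1 adding up to 0.\<close>
  have "(\<Sum>x\<in>UNIV. x + 1) = (\<Sum>x\<in>(UNIV :: 'a set). x)"
    by (rule sum.reindex_bij_witness[of _ "\<lambda>x. x - 1" "\<lambda>x. x + 1"]) auto
  then have "of_nat CARD('a) = (0 :: 'a)" by (simp add: sum.distrib)
  then show ?thesis by (simp only: of_nat_eq_0_iff_char_dvd)
qed

lemma CHAR_primepow_card:
  assumes "primepow CARD('a::{field,finite})"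
  shows "prime CHAR('a) \<and> (\<exists>k. CARD('a) = CHAR('a) ^ k)"
proof -
  have p: "prime CHAR('a)"
    by (rule prime_CHAR_semidom) (rule finite_imp_CHAR_pos, simp)
  obtain l k where "prime l" "CARD('a) = l ^ k" using assms unfolding primepow_def by blast
  then have "CHAR('a) = l"
    using CHAR_dvd_card[where 'a = 'a] p finite by (metis prime_dvd_power primes_dvd_imp_eq)
  then show ?thesis using p \<open>CARD('a) = l ^ k\<close> by blast
qed

lemma two_eq_0_iff_even_card:
  assumes "primepow CARD('a::{field,finite})"
  shows "(2 :: 'a) = 0 \<longleftrightarrow> even CARD('a)"
proof -
  obtain k where p: "prime CHAR('a)" and k: "CARD('a) = CHAR('a) ^ k"
    using CHAR_primepow_card[OF assms] by blast
  have "k > 0" using k assms by (cases k) auto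
  have "(2 :: 'a) = 0 \<longleftrightarrow> of_nat 2 = (0 :: 'a)" by simp
  also have "\<dots> \<longleftrightarrow> CHAR('a) dvd 2" by (rule of_nat_eq_0_iff_char_dvd)
  also have "\<dots> \<longleftrightarrow> CHAR('a) = 2" using p by (auto intro: primes_dvd_imp_eq)
  also have "\<dots> \<longleftrightarrow> even CHAR('a)" using p by (auto dest: primes_dvd_imp_eq[OF two_is_prime_nat])
  also have "\<dots> \<longleftrightarrow> even CARD('a)" unfolding k using \<open>k > 0\<close> by simp
  finally show ?thesis .
qed

section \<open>Decompositions and the integral points they give\<close>

lemma has_at_least_polynomial_points:
  fixes F G :: "'i \<Rightarrow> 'a::field poly"
  assumes "finite D" "inj_on F D" "\<And>d. d \<in> D \<Longrightarrow> (G d)\<^sup>2 = F d ^ 3 + A * F d + B"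
  shows "has_at_least (infty_integral_points (to_fract A) (to_fract B)) (card D)"
  unfolding has_at_least_def
proof (intro exI conjI)
  let ?P = "\<lambda>d. (to_fract (F d), to_fract (G d))"
  show "?P ` D \<subseteq> infty_integral_points (to_fract A) (to_fract B)"
  proof
    fix z assume "z \<in> ?P ` D"
    then obtain d where d: "d \<in> D" "z = ?P d" by blast
    have "to_fract ((G d)\<^sup>2) = to_fract (F d ^ 3 + A * F d + B)"
      using assms(3)[OF d(1)] by simp
    then show "z \<in> infty_integral_points (to_fract A) (to_fract B)"
      unfolding infty_integral_points_def affine_points_def d(2)
      by (simp add: power2_eq_square power3_eq_cube)
  qed
  show "finite (?P ` D)" using assms(1) by simp
  show "card (?P ` D) = card D"
    \<comment> \<open>The first coordinates alone already separate the points.\<close>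
    by (rule card_image) (use assms(2) in \<open>auto simp: inj_on_def\<close>)
qed

text \<open>The last conjunct says that \<open>U d\<close> vanishes at 0 to order
  \<open>(q ^ n + 1) / (q ^ d + 1)\<close>; this value is what later distinguishes the
  divisors.\<close>

lemma exists_norm_decompositions:
  fixes q n :: nat
  assumes "primepow q" and card: "CARD('a::{field,finite}) = q" and "odd q" and "odd n"
  shows "\<exists>U V :: nat \<Rightarrow> 'a poly. (\<forall>d. d dvd n \<longrightarrow>
           U d \<noteq> 0 \<and> U d ^ (q + 1) + V d ^ (q + 1) = [:0, 1:] ^ (q ^ n + 1) + 1 \<and>
           order 0 (U d) * (q ^ d + 1) = q ^ n + 1)"
proof -
  obtain i where p: "prime CHAR('a)" and q: "q = CHAR('a) ^ i"
    using CHAR_primepow_card[where 'a = 'a] assms(1) card by auto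
  have "i > 0" using q assms(1) by (cases i) auto
  have q0: "of_nat q = (0 :: 'a)"
    unfolding q using \<open>i > 0\<close> by simp
  have "(2 :: 'a) \<noteq> 0"
    using two_eq_0_iff_even_card[where 'a = 'a] assms(1) card \<open>odd q\<close> by simp
  define c :: "'a poly" where "c = [:1 / 2:]"
  have c: "2 * c = 1" unfolding c_def using \<open>(2 :: 'a) \<noteq> 0\<close>
    by (simp add: numeral_poly one_pCons)
  have "\<exists>U V :: 'a poly. U \<noteq> 0 \<and> U ^ (q + 1) + V ^ (q + 1) = [:0, 1:] ^ (q ^ n + 1) + 1 \<and>
           order 0 U * (q ^ d + 1) = q ^ n + 1" if "d dvd n" for d
  proof -
    obtain m where m: "n = d * m" using \<open>d dvd n\<close> by (rule dvdE)
    have "odd d" "odd m" using \<open>odd n\<close> m by auto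
    obtain e where e: "odd e" "q ^ d + 1 = e * (q + 1)"
      using odd_power_Suc_factor[OF \<open>odd q\<close> \<open>odd d\<close>] by blast
    \<comment> \<open>The cofactor lemma again, now with base \<open>q ^ d\<close>; \<open>k\<close>
      is the exponent of t in \<open>T\<close>.\<close>
    obtain k where k: "(q ^ d) ^ m + 1 = k * (q ^ d + 1)"
      using odd_power_Suc_factor[of "q ^ d" m] \<open>odd q\<close> \<open>odd m\<close> by auto
    have "k > 0" using k by (cases k) auto
    have "d > 0" using \<open>odd d\<close> by (cases d) auto
    define T :: "'a poly" where "T = [:0, 1:] ^ k"
    have T: "T = monom 1 k" unfolding T_def by (simp add: monom_altdef)
    define U where "U = c * ((T + 1) ^ e + (T - 1) ^ e)"
    define V where "V = c * ((T + 1) ^ e - (T - 1) ^ e)"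
    have "q ^ d = CHAR('a poly) ^ (i * d)" using q by (simp add: power_mult)
    then have "U ^ (q + 1) + V ^ (q + 1) = T ^ (q ^ d + 1) + 1"
      unfolding U_def V_def using p q c e(2)
      by (intro frobenius_norm_identity[where i = i and j = "i * d"]) auto
    also have "T ^ (q ^ d + 1) = [:0, 1:] ^ (q ^ n + 1)"
      unfolding T_def m using k by (simp only: power_mult[symmetric])
    finally have norm: "U ^ (q + 1) + V ^ (q + 1) = [:0, 1:] ^ (q ^ n + 1) + 1" .
    obtain s where s: "U = T * (of_nat e + T * s)"
      using odd_power_half_sum_expansion[OF e(1) c, of T] unfolding U_def by blast
    \<comment> \<open>Since \<open>q\<close> is 0 in the field and \<open>d > 0\<close>, the
      relation \<open>q ^ d + 1 = e * (q + 1)\<close> reduces to 1 = \<open>e\<close>.\<close>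
    have "of_nat (q ^ d + 1) = (of_nat (e * (q + 1)) :: 'a)" using e(2) by simp
    then have "of_nat e = (1 :: 'a)" using q0 \<open>d > 0\<close> by (simp add: zero_power)
    then have W: "poly (of_nat e + T * s) 0 \<noteq> 0"
      unfolding T_def using \<open>k > 0\<close> by (simp add: zero_power)
    then have W0: "of_nat e + T * s \<noteq> 0" by (metis poly_0)
    have "T \<noteq> 0" unfolding T_def by simp
    then have "U \<noteq> 0" using s W0 by simp
    then have "order 0 U = order 0 T + order 0 (of_nat e + T * s)"
      unfolding s by (rule order_mult)
    also have "\<dots> = k" using W unfolding T by (simp add: order_0I)
    finally have "order 0 U * (q ^ d + 1) = q ^ n + 1"
      unfolding m using k by (simp add: power_mult)
    then show ?thesis using norm \<open>U \<noteq> 0\<close> by blast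
  qed
  then show ?thesis by metis
qed

lemma norm_decompositions:
  fixes q n :: nat
  assumes "primepow q" and "CARD('a::{field,finite}) = q" and "odd q" and "odd n"
  shows "\<exists>U V :: nat \<Rightarrow> 'a poly.
    (\<forall>d. d dvd n \<longrightarrow> U d ^ (q + 1) + V d ^ (q + 1) = [:0, 1:] ^ (q ^ n + 1) + 1) \<and>
    (\<forall>j>0. inj_on (\<lambda>d. - (U d ^ j)) {d. d dvd n})"
proof -
  obtain U V :: "nat \<Rightarrow> 'a poly" where UV: "\<And>d. d dvd n \<Longrightarrow>
           U d \<noteq> 0 \<and> U d ^ (q + 1) + V d ^ (q + 1) = [:0, 1:] ^ (q ^ n + 1) + 1 \<and>
           order 0 (U d) * (q ^ d + 1) = q ^ n + 1"
    using exists_norm_decompositions[OF assms] by blast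
  have "q > 1" using assms(1) by (rule primepow_gt_Suc_0[unfolded One_nat_def[symmetric]])
  have "inj_on (\<lambda>d. - (U d ^ j)) {d. d dvd n}" if "j > 0" for j
  proof (rule inj_onI)
    fix d d' assume "d \<in> {d. d dvd n}" "d' \<in> {d. d dvd n}" "- (U d ^ j) = - (U d' ^ j)"
    then have d: "d dvd n" and d': "d' dvd n" and "order 0 (U d ^ j) = order 0 (U d' ^ j)"
      by auto
    then have "order 0 (U d) = order 0 (U d')"
      using UV \<open>j > 0\<close> by (simp add: order_power_eq)
    \<comment> \<open>A nonzero order can be cancelled from
      \<open>order 0 (U d) * (q ^ d + 1) = q ^ n + 1\<close>.\<close>
    moreover have "order 0 (U d) \<noteq> 0" using UV[OF d] by (metis add_is_0 mult_0 one_neq_zero)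
    ultimately have "q ^ d = q ^ d'"
      using UV[OF d] UV[OF d'] by (metis add_right_cancel mult_left_cancel)
    then show "d = d'" using \<open>q > 1\<close> by (simp add: power_inject_exp)
  qed
  then show ?thesis using UV by blast
qed

theorem theorem2p20:
  fixes q n :: nat and t :: "'a::{field,finite} poly fract"
  assumes "primepow q"
    and "CARD('a) = q"
    and "odd n"
    and "t = ratfun_t"
  shows
    "(q mod 4 = 3 \<longrightarrow>
        elliptic_curve (- (t ^ (q ^ n + 1) + 1)) 0 \<and>
        has_at_least (infty_integral_points (- (t ^ (q ^ n + 1) + 1)) 0) (num_divisors n)) \<and>
     (q mod 3 = 2 \<longrightarrow>
        elliptic_curve 0 (t ^ (q ^ n + 1) + 1) \<longrightarrow>
        has_at_least (infty_integral_points 0 (t ^ (q ^ n + 1) + 1)) (num_divisors n))"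
proof -
  define h :: "'a poly" where "h = [:0, 1:] ^ (q ^ n + 1) + 1"
  have fract_power: "to_fract (x ^ m) = to_fract x ^ m" for x :: "'a poly" and m
    by (induction m) simp_all
  have fract_h: "t ^ (q ^ n + 1) + 1 = to_fract h"
    unfolding h_def assms(4) ratfun_t_def by (simp only: to_fract_add fract_power to_fract_1)
  have fin: "finite {d. d dvd n}" using \<open>odd n\<close> by (intro finite_divisors_nat) (cases n, auto)
  have "h \<noteq> 0"
  proof
    assume "h = 0"
    then have "poly h 0 = 0" by simp
    then show False unfolding h_def by simp
  qed
  \<comment> \<open>Written as a constant polynomial, 2 vanishes in the function field exactly when
    it does in the finite field.\<close>
  have two_fract: "(2 :: 'a poly fract) = to_fract [:2:]"
  proof -
    have "(2 :: 'a poly fract) = to_fract (1 + 1)" by (subst to_fract_add) simp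
    also have "(1 + 1 :: 'a poly) = [:2:]" by (simp add: one_pCons)
    finally show ?thesis .
  qed
  have two_iff: "(2 :: 'a poly fract) = 0 \<longleftrightarrow> even q"
    unfolding two_fract using two_eq_0_iff_even_card[where 'a = 'a] assms(1,2) by simp
  have part1: "elliptic_curve (- to_fract h) 0 \<and>
      has_at_least (infty_integral_points (- to_fract h) 0) (num_divisors n)" if q4: "q mod 4 = 3"
  proof
    define j where "j = q div 4 + 1"
    have j: "q + 1 = 4 * j" "j > 0"
      using q4 div_mult_mod_eq[of q 4] unfolding j_def by simp_all
    have "even (q + 1)" unfolding j(1) by simp
    then have "odd q" by simp
    have disc: "- 16 * (4 * (- to_fract h) ^ 3 + 27 * 0 ^ 2) = 2 ^ 6 * to_fract h ^ 3" by simp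
    have "2 ^ 6 * to_fract h ^ 3 \<noteq> 0"
      using two_iff \<open>odd q\<close> \<open>h \<noteq> 0\<close>
      by (simp only: mult_eq_0_iff power_eq_0_iff to_fract_eq_0_iff simp_thms)
    then show "elliptic_curve (- to_fract h) 0"
      unfolding elliptic_curve_def disc .
    obtain U V :: "nat \<Rightarrow> 'a poly"
      where norm: "\<And>d. d dvd n \<Longrightarrow> U d ^ (q + 1) + V d ^ (q + 1) = [:0, 1:] ^ (q ^ n + 1) + 1"
        and inj: "\<And>j. j > 0 \<Longrightarrow> inj_on (\<lambda>d. - (U d ^ j)) {d. d dvd n}"
      using norm_decompositions[OF assms(1,2) \<open>odd q\<close> assms(3)] by blast
    \<comment> \<open>Here 4 * \<open>j\<close> = \<open>q + 1\<close>. At x =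
      \<open>- (U d ^ (2 * j))\<close> the terms in \<open>U d ^ (6 * j)\<close> cancel in x^3 -
      \<open>h\<close> x, leaving the square \<open>U d ^ (2 * j) * V d ^ (4 * j)\<close>.\<close>
    have "(U d ^ j * V d ^ (2 * j))\<^sup>2 = (- (U d ^ (2 * j))) ^ 3 + - h * - (U d ^ (2 * j)) + 0"
      if "d \<in> {d. d dvd n}" for d
    proof -
      have "h = U d ^ (4 * j) + V d ^ (4 * j)"
        using norm[of d] that unfolding h_def j(1) by simp
      then show ?thesis
        by (simp add: power_mult_distrib power_mult[symmetric] power_add[symmetric] algebra_simps)
    qed
    then have "has_at_least (infty_integral_points (to_fract (- h)) (to_fract 0)) (num_divisors n)"
      unfolding num_divisors_def
      using fin inj[of "2 * j"] j(2) by (intro has_at_least_polynomial_points) auto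
    then show "has_at_least (infty_integral_points (- to_fract h) 0) (num_divisors n)" by simp
  qed
  have part2: "has_at_least (infty_integral_points 0 (to_fract h)) (num_divisors n)"
    if q3: "q mod 3 = 2" and ell: "elliptic_curve 0 (to_fract h)"
  proof -
    \<comment> \<open>The congruence mod 3 also admits powers of 2 such as \<open>q\<close> = 2;
      there the discriminant is 0, contradicting \<open>ell\<close>.\<close>
    have "odd q"
    proof
      assume "even q"
      then have two: "(2 :: 'a poly fract) = 0" using two_iff by blast
      have "(16 :: 'a poly fract) = 2 ^ 4" by simp
      also have "\<dots> = 0" unfolding two by (rule power_zero_numeral)
      finally have "- 16 * x = 0" for x :: "'a poly fract"
        by (metis minus_zero mult_zero_left)
      then show False using ell unfolding elliptic_curve_def by blast
    qed
    obtain U V :: "nat \<Rightarrow> 'a poly"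
      where norm: "\<And>d. d dvd n \<Longrightarrow> U d ^ (q + 1) + V d ^ (q + 1) = [:0, 1:] ^ (q ^ n + 1) + 1"
        and inj: "\<And>j. j > 0 \<Longrightarrow> inj_on (\<lambda>d. - (U d ^ j)) {d. d dvd n}"
      using norm_decompositions[OF assms(1,2) \<open>odd q\<close> assms(3)] by blast
    have "q + 1 = 3 * (q div 3 + 1)" using q3 div_mult_mod_eq[of q 3] by simp
    then have "3 dvd q + 1" by (rule dvdI)
    moreover have "2 dvd q + 1" using \<open>odd q\<close> by simp
    ultimately have "2 * 3 dvd q + 1" by (intro divides_mult) simp_all
    then obtain j where j: "q + 1 = 6 * j" by auto
    then have "j > 0" by (cases j) simp_all
    \<comment> \<open>With 6 * \<open>j\<close> = \<open>q + 1\<close>, the cube of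
      \<open>- (U d ^ (2 * j))\<close> cancels the first summand of \<open>h\<close>, leaving
      \<open>V d ^ (6 * j)\<close>.\<close>
    have "(V d ^ (3 * j))\<^sup>2 = (- (U d ^ (2 * j))) ^ 3 + 0 * - (U d ^ (2 * j)) + h"
      if "d \<in> {d. d dvd n}" for d
    proof -
      have "h = U d ^ (6 * j) + V d ^ (6 * j)"
        using norm[of d] that unfolding h_def j by simp
      then show ?thesis by (simp flip: power_mult add: mult.commute)
    qed
    then have "has_at_least (infty_integral_points (to_fract 0) (to_fract h)) (num_divisors n)"
      unfolding num_divisors_def
      using fin inj[of "2 * j"] \<open>j > 0\<close> by (intro has_at_least_polynomial_points) auto
    then show ?thesis by simp
  qed
  show ?thesis unfolding fract_h using part1 part2 by blast
qed

end
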